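(* Let $H$ be a separable infinite-dimensional complex Hilbert space and let $T\in L(H)$ be a contraction. If $T$ is not completely non-unitary, then $T$ has a non-trivial invariant subspace.
   Context: $L(H)$ is the set of bounded linear operators from $H$ to $H$. A contraction is an operator $T\in L(H)$ with $\|T\|\le 1$; it is completely non-unitary if its restriction to any non-zero reducing subspace is never unitary. A non-trivial invariant subspace of $T$ is a closed linear subspace $M\subseteq H$ with $TM\subseteq M$, $M\neq\{0\}$ and $M\neq H$. *)

theory Defs
  imports "HOL-Analysis.Analysis"
begin

section \<open>Complex Hilbert spaces\<close>

text \<open>
  A complex Hilbert space is modelled by a type class extending the real normed spaces of the
  library, so that limits, closedness, completeness and \<^const>\<open>onorm\<close> are those of the library.
  The inner product is linear in its first argument, and the norm is the one it induces
  (this includes positive definiteness).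
\<close>

class complex_vector = real_vector +
  fixes scaleC :: "complex \<Rightarrow> 'a \<Rightarrow> 'a"  (infixr \<open>*\<^sub>C\<close> 75)
  assumes scaleC_add_right: "a *\<^sub>C (x + y) = a *\<^sub>C x + a *\<^sub>C y"
    and scaleC_add_left: "(a + b) *\<^sub>C x = a *\<^sub>C x + b *\<^sub>C x"
    and scaleC_scaleC: "a *\<^sub>C (b *\<^sub>C x) = (a * b) *\<^sub>C x"
    and scaleC_one: "1 *\<^sub>C x = x"
    and scaleR_eq_scaleC: "r *\<^sub>R x = complex_of_real r *\<^sub>C x"

class complex_hilbert_space = complex_vector + banach +
  fixes cinner :: "'a \<Rightarrow> 'a \<Rightarrow> complex"
  assumes cinner_commute: "cinner x y = cnj (cinner y x)"
    and cinner_add_left: "cinner (x + y) z = cinner x z + cinner y z"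
    and cinner_scaleC_left: "cinner (a *\<^sub>C x) y = a * cinner x y"
    and cinner_self: "cinner x x = complex_of_real ((norm x)\<^sup>2)"

global_interpretation complex_vector:
  vector_space "scaleC :: complex \<Rightarrow> 'a \<Rightarrow> 'a::complex_vector"
  defines csubspace = complex_vector.subspace
    and cspan = complex_vector.span
  by unfold_locales
    (simp_all add: scaleC_add_right scaleC_add_left scaleC_scaleC scaleC_one)

text \<open>Infinite-dimensionality over the complex numbers, as a property of the type.\<close>

definition infinite_dimensional :: "'a::complex_vector itself \<Rightarrow> bool" where
  "infinite_dimensional _ \<longleftrightarrow> (\<nexists>B :: 'a set. finite B \<and> cspan B = UNIV)"

definition closed_csubspace :: "'a::complex_hilbert_space set \<Rightarrow> bool" where
  "closed_csubspace M \<longleftrightarrow> csubspace M \<and> closed M"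

definition orth_complement :: "'a::complex_hilbert_space set \<Rightarrow> 'a set" where
  "orth_complement M = {x. \<forall>y\<in>M. cinner x y = 0}"

section \<open>Operators\<close>

definition bounded_clinear :: "('a::complex_hilbert_space \<Rightarrow> 'a) \<Rightarrow> bool" where
  "bounded_clinear T \<longleftrightarrow>
     Vector_Spaces.linear scaleC scaleC T \<and> (\<exists>K. \<forall>x. norm (T x) \<le> norm x * K)"

definition contraction :: "('a::complex_hilbert_space \<Rightarrow> 'a) \<Rightarrow> bool" where
  "contraction T \<longleftrightarrow> bounded_clinear T \<and> onorm T \<le> 1"

definition nontrivial_invariant_subspace ::
    "('a::complex_hilbert_space \<Rightarrow> 'a) \<Rightarrow> 'a set \<Rightarrow> bool" where
  "nontrivial_invariant_subspace T M \<longleftrightarrow>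
     closed_csubspace M \<and> T ` M \<subseteq> M \<and> M \<noteq> {0} \<and> M \<noteq> UNIV"

definition reducing_subspace :: "('a::complex_hilbert_space \<Rightarrow> 'a) \<Rightarrow> 'a set \<Rightarrow> bool" where
  "reducing_subspace T M \<longleftrightarrow>
     closed_csubspace M \<and> T ` M \<subseteq> M \<and> T ` orth_complement M \<subseteq> orth_complement M"

text \<open>
  For a closed subspace \<open>M\<close> that is invariant under \<open>T\<close>: \<open>S\<close>, restricted to \<open>M\<close>, is the
  adjoint of the restriction of \<open>T\<close> to \<open>M\<close>, taken in the Hilbert space \<open>M\<close>. The values of
  \<open>S\<close> on \<open>M\<close> are uniquely determined; its values outside \<open>M\<close> are irrelevant.
\<close>

definition is_adjoint_on ::
    "'a::complex_hilbert_space set \<Rightarrow> ('a \<Rightarrow> 'a) \<Rightarrow> ('a \<Rightarrow> 'a) \<Rightarrow> bool" where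
  "is_adjoint_on M T S \<longleftrightarrow>
     S ` M \<subseteq> M \<and> (\<forall>x\<in>M. \<forall>y\<in>M. cinner (T x) y = cinner x (S y))"

text \<open>The restriction \<open>U\<close> of \<open>T\<close> to \<open>M\<close> satisfies \<open>U* U = U U* = I\<close> on \<open>M\<close>.\<close>

definition unitary_on :: "'a::complex_hilbert_space set \<Rightarrow> ('a \<Rightarrow> 'a) \<Rightarrow> bool" where
  "unitary_on M T \<longleftrightarrow>
     T ` M \<subseteq> M \<and>
     (\<exists>S. is_adjoint_on M T S \<and> (\<forall>x\<in>M. S (T x) = x) \<and> (\<forall>x\<in>M. T (S x) = x))"

definition completely_non_unitary :: "('a::complex_hilbert_space \<Rightarrow> 'a) \<Rightarrow> bool" where
  "completely_non_unitary T \<longleftrightarrow>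
     (\<forall>M. reducing_subspace T M \<and> M \<noteq> {0} \<longrightarrow> \<not> unitary_on M T)"

end

theory Submission
  imports Defs
begin

text \<open>
  If \<open>T\<close> is unitary on a non-zero reducing subspace other than the whole space, that subspace
  is itself invariant, so the point of the theorem is that a unitary operator \<open>T\<close> on an
  infinite-dimensional space always has a non-trivial invariant subspace. Up to real factors,
  its real and imaginary parts are \<open>T + T\<^sup>*\<close> and \<open>\<i>(T - T\<^sup>*)\<close>; they are self-adjoint and commute
  with \<open>T\<close>; if both are scalar then so is \<open>T\<close>, and every closed subspace is invariant.

  So let \<open>A\<close> be self-adjoint, not scalar, and commute with \<open>T\<close>. Its quadratic form takes values
  on both sides of some level \<open>\<mu>\<close>, hence \<open>B = A - \<mu>\<close> is neither positive nor negative. The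
  spectral theorem would now supply the spectral projection of \<open>B\<close> for the positive half-line,
  but much less is enough: an absolute value \<open>S \<ge> 0\<close> with \<open>S\<^sup>2 = B\<^sup>2\<close> that commutes with
  everything that commutes with \<open>B\<close> (lemma \<open>symmetric_absolute_value\<close>). Indeed
  \<open>(S - B)(S + B) = 0\<close> while \<open>S \<noteq> B\<close> and \<open>S \<noteq> -B\<close>, so the kernel of \<open>S - B\<close> is closed,
  invariant under \<open>T\<close>, not the whole space, and not zero because it contains the range of
  \<open>S + B\<close> (lemmas \<open>symmetric_sign_if_no_invariant_subspace\<close> and \<open>symmetric_commuting_scalar\<close>).

  After scaling, \<open>\<parallel>B\<parallel> \<le> 1\<close>, and \<open>S = I - Y\<close> where \<open>Y\<close> solves \<open>Y = (X + Y\<^sup>2)/2\<close> for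
  \<open>X = I - B\<^sup>2\<close>. The fixed-point iteration for this equation converges in operator norm whenever
  \<open>\<parallel>X\<parallel> \<le> 1\<close>, since it is dominated by the same iteration for the number 1 in place of \<open>X\<close>
  (lemma \<open>operator_quadratic_fixed_point\<close>).
\<close>

section \<open>A quadratic fixed-point equation for operators\<close>

primrec half_square_iter :: "('a::banach \<Rightarrow>\<^sub>L 'a) \<Rightarrow> nat \<Rightarrow> ('a \<Rightarrow>\<^sub>L 'a)" where
  "half_square_iter X 0 = 0"
| "half_square_iter X (Suc n) =
     (1/2) *\<^sub>R (X + (half_square_iter X n o\<^sub>L half_square_iter X n))"

text \<open>The scalar iteration for \<open>X = 1\<close>, which majorises the operator iteration.\<close>

primrec half_square_bound :: "nat \<Rightarrow> real" where
  "half_square_bound 0 = 0"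
| "half_square_bound (Suc n) = (1 + (half_square_bound n)\<^sup>2) / 2"

lemma half_square_bound_range: "0 \<le> half_square_bound n \<and> half_square_bound n \<le> 1"
  by (induction n) (auto simp: power_le_one)

lemma half_square_bound_Suc_ge: "half_square_bound n \<le> half_square_bound (Suc n)"
proof -
  have "0 \<le> (half_square_bound n - 1)\<^sup>2" by simp
  then show ?thesis by (simp add: power2_eq_square algebra_simps)
qed

lemma Cauchy_half_square_bound: "Cauchy half_square_bound"
proof -
  have "incseq half_square_bound"
    by (intro incseq_SucI half_square_bound_Suc_ge)
  moreover have "\<forall>n. half_square_bound n \<le> 1"
    using half_square_bound_range by blast
  ultimately obtain l where "half_square_bound \<longlonglongrightarrow> l"
    by (rule incseq_convergent)
  then show ?thesis by (rule LIMSEQ_imp_Cauchy)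
qed

lemma norm_half_square_iter:
  assumes "norm X \<le> 1"
  shows "norm (half_square_iter X n) \<le> half_square_bound n"
proof (induction n)
  case (Suc n)
  let ?Y = "half_square_iter X n"
  have "norm (?Y o\<^sub>L ?Y) \<le> (half_square_bound n)\<^sup>2"
    using norm_blinfun_compose[of ?Y ?Y] mult_mono'[OF Suc Suc]
    by (simp add: power2_eq_square)
  then have "norm (X + (?Y o\<^sub>L ?Y)) \<le> 1 + (half_square_bound n)\<^sup>2"
    by (rule order_trans[OF norm_triangle_ineq add_mono[OF assms]])
  then show ?case by simp
qed simp

text \<open>
  From \<open>P\<^sup>2 - Q\<^sup>2 = P(P - Q) + (P - Q)Q\<close> the increments satisfy the recursive estimate that the
  increments of the scalar iteration satisfy with equality.
\<close>

lemma norm_half_square_iter_step: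
  assumes "norm X \<le> 1"
  shows "norm (half_square_iter X (Suc n) - half_square_iter X n)
           \<le> half_square_bound (Suc n) - half_square_bound n"
proof (induction n)
  case 0
  show ?case using assms by simp
next
  case (Suc n)
  define P Q where "P = half_square_iter X (Suc n)" and "Q = half_square_iter X n"
  define p q where "p = half_square_bound (Suc n)" and "q = half_square_bound n"
  have P: "norm P \<le> p" and Q: "norm Q \<le> q" and PQ: "norm (P - Q) \<le> p - q"
    using norm_half_square_iter[OF assms] Suc by (auto simp only: P_def Q_def p_def q_def)
  have "half_square_iter X (Suc (Suc n)) - P
      = (1/2) *\<^sub>R (X + (P o\<^sub>L P)) - (1/2) *\<^sub>R (X + (Q o\<^sub>L Q))"
    by (simp only: P_def Q_def half_square_iter.simps(2))
  also have "\<dots> = (1/2) *\<^sub>R ((P o\<^sub>L (P - Q)) + ((P - Q) o\<^sub>L Q))"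
    by (auto intro!: blinfun_eqI simp: blinfun.bilinear_simps algebra_simps)
  finally have step: "half_square_iter X (Suc (Suc n)) - P
      = (1/2) *\<^sub>R ((P o\<^sub>L (P - Q)) + ((P - Q) o\<^sub>L Q))" .
  have "norm (P o\<^sub>L (P - Q)) \<le> p * (p - q)"
    by (rule order_trans[OF norm_blinfun_compose]) (intro mult_mono' P PQ norm_ge_zero)
  moreover have "norm ((P - Q) o\<^sub>L Q) \<le> (p - q) * q"
    by (rule order_trans[OF norm_blinfun_compose]) (intro mult_mono' Q PQ norm_ge_zero)
  ultimately have "norm ((P o\<^sub>L (P - Q)) + ((P - Q) o\<^sub>L Q)) \<le> p * (p - q) + (p - q) * q"
    by - (rule norm_triangle_le, linarith)
  moreover have "2 * p = 1 + q\<^sup>2" and "2 * half_square_bound (Suc (Suc n)) = 1 + p\<^sup>2"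
    by (simp_all only: p_def q_def half_square_bound.simps) simp_all
  then have "p * (p - q) + (p - q) * q = 2 * (half_square_bound (Suc (Suc n)) - p)"
    by (simp add: power2_eq_square algebra_simps)
  ultimately have "norm (half_square_iter X (Suc (Suc n)) - P)
      \<le> half_square_bound (Suc (Suc n)) - p"
    unfolding step by (simp del: half_square_bound.simps)
  then show ?case by (simp only: P_def p_def)
qed

lemma dist_half_square_iter:
  assumes "norm X \<le> 1" and "m \<le> n"
  shows "dist (half_square_iter X m) (half_square_iter X n)
           \<le> dist (half_square_bound m) (half_square_bound n)"
proof -
  have "norm (half_square_iter X n - half_square_iter X m)
          \<le> half_square_bound n - half_square_bound m"
    using assms(2)
  proof (induction n rule: dec_induct)
    case (step k)
    have "norm ((half_square_iter X (Suc k) - half_square_iter X k)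
            + (half_square_iter X k - half_square_iter X m))
          \<le> half_square_bound (Suc k) - half_square_bound m"
      using norm_half_square_iter_step[OF assms(1), of k] step.IH
      by - (rule norm_triangle_le, linarith)
    then show ?case by (simp only: diff_add_cancel add_diff_eq)
  qed simp
  then show ?thesis by (simp add: dist_norm norm_minus_commute)
qed

text \<open>
  The solution is a norm limit of polynomials in \<open>X\<close>, so it commutes with
  every operator that commutes with \<open>X\<close>. All operators here are only real-linear: this allows multiplication by a
  complex scalar to be one of the operators \<open>D\<close>.
\<close>

lemma operator_quadratic_fixed_point:
  fixes X :: "'a::banach \<Rightarrow>\<^sub>L 'a"
  assumes "norm X \<le> 1"
  obtains Y :: "'a \<Rightarrow>\<^sub>L 'a" where "norm Y \<le> 1" and "Y = (1/2) *\<^sub>R (X + (Y o\<^sub>L Y))"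
    and "\<And>D. D o\<^sub>L X = X o\<^sub>L D \<Longrightarrow> D o\<^sub>L Y = Y o\<^sub>L D"
proof -
  let ?Y = "half_square_iter X"
  have "Cauchy ?Y"
  proof (rule metric_CauchyI)
    fix e :: real assume "0 < e"
    then obtain N where N: "\<And>m n. N \<le> m \<Longrightarrow> N \<le> n
        \<Longrightarrow> dist (half_square_bound m) (half_square_bound n) < e"
      using metric_CauchyD[OF Cauchy_half_square_bound] by blast
    have "dist (?Y m) (?Y n) < e" if "N \<le> m" "N \<le> n" for m n
      using dist_half_square_iter[OF assms, of m n] dist_half_square_iter[OF assms, of n m]
        N[OF that] by (cases "m \<le> n") (auto simp: dist_commute)
    then show "\<exists>N. \<forall>m\<ge>N. \<forall>n\<ge>N. dist (?Y m) (?Y n) < e" by blast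
  qed
  then obtain Y where Y: "?Y \<longlonglongrightarrow> Y"
    using Cauchy_convergent convergent_def by blast
  note compose_limits = bounded_bilinear.tendsto[OF bounded_bilinear_blinfun_compose]
  show thesis
  proof
    have "norm (?Y n) \<le> 1" for n
      using norm_half_square_iter[OF assms, of n] half_square_bound_range[of n] by linarith
    then show "norm Y \<le> 1"
      by (intro LIMSEQ_le_const2[OF tendsto_norm[OF Y]]) blast
    have "(\<lambda>n. ?Y (Suc n)) \<longlonglongrightarrow> (1/2) *\<^sub>R (X + (Y o\<^sub>L Y))"
      unfolding half_square_iter.simps by (intro tendsto_intros compose_limits Y)
    then show "Y = (1/2) *\<^sub>R (X + (Y o\<^sub>L Y))"
      by (rule LIMSEQ_unique[OF LIMSEQ_Suc[OF Y]])
  next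
    fix D assume D: "D o\<^sub>L X = X o\<^sub>L D"
    have comm: "D o\<^sub>L ?Y n = ?Y n o\<^sub>L D" for n
    proof (induction n)
      case (Suc n)
      have DX: "D (X x) = X (D x)" and DY: "D (?Y n x) = ?Y n (D x)" for x
        using D Suc by (metis blinfun_apply_blinfun_compose)+
      show ?case
        by (rule blinfun_eqI) (simp add: blinfun.bilinear_simps DX DY)
    qed (auto intro!: blinfun_eqI simp: blinfun.bilinear_simps)
    have "(\<lambda>n. D o\<^sub>L ?Y n) \<longlonglongrightarrow> (D o\<^sub>L Y)"
      and "(\<lambda>n. ?Y n o\<^sub>L D) \<longlonglongrightarrow> (Y o\<^sub>L D)"
      by (intro compose_limits Y tendsto_const)+
    then show "D o\<^sub>L Y = Y o\<^sub>L D"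
      unfolding comm by (rule LIMSEQ_unique)
  qed
qed

section \<open>The real inner product\<close>

abbreviation rinner :: "'a::complex_hilbert_space \<Rightarrow> 'a \<Rightarrow> real" where
  "rinner x y \<equiv> Re (cinner x y)"

lemma rinner_commute: "rinner x y = rinner y x"
  using cinner_commute[of x y] by simp

lemma rinner_add_left: "rinner (x + y) z = rinner x z + rinner y z"
  by (simp add: cinner_add_left)

lemma rinner_scaleR_left: "rinner (r *\<^sub>R x) y = r * rinner x y"
  by (simp add: scaleR_eq_scaleC cinner_scaleC_left)

lemma rinner_minus_left: "rinner (- x) y = - rinner x y"
  using rinner_scaleR_left[of "-1" x y] by simp

lemma rinner_diff_left: "rinner (x - y) z = rinner x z - rinner y z"
  using rinner_add_left[of x "- y" z] by (simp add: rinner_minus_left)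

lemma rinner_add_right: "rinner x (y + z) = rinner x y + rinner x z"
  and rinner_scaleR_right: "rinner x (r *\<^sub>R y) = r * rinner x y"
  and rinner_minus_right: "rinner x (- y) = - rinner x y"
  and rinner_diff_right: "rinner x (y - z) = rinner x y - rinner x z"
  using rinner_add_left[of y z x] rinner_scaleR_left[of r y x] rinner_minus_left[of y x]
    rinner_diff_left[of y z x]
  by (simp_all only: rinner_commute[of _ x])

lemma rinner_self: "rinner x x = (norm x)\<^sup>2"
  by (simp add: cinner_self)

lemmas rinner_simps = rinner_add_left rinner_add_right rinner_scaleR_left rinner_scaleR_right
  rinner_minus_left rinner_minus_right rinner_diff_left rinner_diff_right rinner_self

text \<open>
  The triangle inequality is part of the structure, so Cauchy-Schwarz is obtained by
  expanding \<open>\<parallel>x + y\<parallel>\<^sup>2 \<le> (\<parallel>x\<parallel> + \<parallel>y\<parallel>)\<^sup>2\<close>.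
\<close>

lemma rinner_le_norm: "rinner x y \<le> norm x * norm y"
proof -
  have "(norm (x + y))\<^sup>2 \<le> (norm x + norm y)\<^sup>2"
    by (simp add: norm_triangle_ineq power_mono)
  moreover have "(norm (x + y))\<^sup>2 = (norm x)\<^sup>2 + 2 * rinner x y + (norm y)\<^sup>2"
    using rinner_commute[of x y] by (simp add: rinner_self[symmetric] rinner_add_left rinner_add_right)
  ultimately show ?thesis by (simp add: power2_eq_square algebra_simps)
qed

lemma bounded_linear_rinner_left: "bounded_linear (\<lambda>x. rinner x y)"
proof (rule bounded_linear_intro[where K = "norm y"])
  fix x
  have "- rinner x y \<le> norm x * norm y"
    using rinner_le_norm[of "- x" y] by (simp add: rinner_minus_left)
  then show "norm (rinner x y) \<le> norm x * norm y"
    using rinner_le_norm[of x y] by (simp add: abs_le_iff)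
qed (simp_all add: rinner_add_left rinner_scaleR_left)

lemma norm_scaleC: "norm (c *\<^sub>C x) = cmod c * norm (x::'a::complex_hilbert_space)"
proof -
  have "complex_of_real ((norm (c *\<^sub>C x))\<^sup>2) = cinner (c *\<^sub>C x) (c *\<^sub>C x)"
    by (simp only: cinner_self)
  also have "\<dots> = c * cnj (cinner (c *\<^sub>C x) x)"
    by (metis cinner_scaleC_left cinner_commute)
  also have "\<dots> = (c * cnj c) * complex_of_real ((norm x)\<^sup>2)"
    by (simp add: cinner_scaleC_left cinner_self)
  also have "\<dots> = complex_of_real ((cmod c * norm x)\<^sup>2)"
    by (simp add: complex_norm_square power_mult_distrib flip: of_real_power)
  finally have "(norm (c *\<^sub>C x))\<^sup>2 = (cmod c * norm x)\<^sup>2"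
    by (simp only: of_real_eq_iff)
  then show ?thesis by (simp add: power2_eq_iff_nonneg)
qed

lemma scaleC_scaleR: "c *\<^sub>C (r *\<^sub>R x) = r *\<^sub>R (c *\<^sub>C x)"
  by (simp add: scaleR_eq_scaleC scaleC_scaleC mult.commute)

lemma bounded_linear_scaleC: "bounded_linear (\<lambda>x::'a::complex_hilbert_space. c *\<^sub>C x)"
  by (rule bounded_linear_intro[where K = "cmod c"])
     (simp_all add: scaleC_add_right scaleC_scaleR norm_scaleC)

section \<open>Absolute values and invariant subspaces\<close>

text \<open>
  \<open>S = I - Y\<close> satisfies \<open>S\<^sup>2 = I - X\<close> exactly when \<open>Y = (X + Y\<^sup>2)/2\<close>, and \<open>\<parallel>Y\<parallel> \<le> 1\<close> already makes
  the form of \<open>S\<close> non-negative. The bound \<open>\<parallel>X\<parallel> \<le> 1\<close> comes from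
  \<open>\<parallel>x - B\<^sup>2 x\<parallel>\<^sup>2 = \<parallel>x\<parallel>\<^sup>2 - 2 \<parallel>B x\<parallel>\<^sup>2 + \<parallel>B\<^sup>2 x\<parallel>\<^sup>2\<close>.
\<close>

lemma symmetric_absolute_value:
  fixes B :: "'a::complex_hilbert_space \<Rightarrow>\<^sub>L 'a"
  assumes norm: "norm B \<le> 1"
    and symmetric: "\<And>x y. rinner (B x) y = rinner x (B y)"
  obtains S :: "'a \<Rightarrow>\<^sub>L 'a" where "\<And>x. S (S x) = B (B x)" and "\<And>x. 0 \<le> rinner (S x) x"
    and "\<And>D. D o\<^sub>L B = B o\<^sub>L D \<Longrightarrow> D o\<^sub>L S = S o\<^sub>L D"
proof -
  define X where "X = id_blinfun - (B o\<^sub>L B)"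
  have X_apply: "X x = x - B (B x)" for x
    by (simp add: X_def blinfun.bilinear_simps)
  have contractive: "norm (B x) \<le> norm x" for x
    using norm_blinfun[of B x] norm mult_right_mono[of "norm B" 1 "norm x"] by simp
  have "norm (X x) \<le> norm x" for x
  proof -
    have "(norm (X x))\<^sup>2 = (norm x)\<^sup>2 - 2 * rinner (B (B x)) x + (norm (B (B x)))\<^sup>2"
      using rinner_commute[of x "B (B x)"]
      by (simp add: X_apply rinner_self[symmetric] rinner_diff_left rinner_diff_right)
    also have "rinner (B (B x)) x = (norm (B x))\<^sup>2"
      by (simp only: symmetric rinner_self)
    finally have "(norm (X x))\<^sup>2 = (norm x)\<^sup>2 - 2 * (norm (B x))\<^sup>2 + (norm (B (B x)))\<^sup>2" .
    moreover have "(norm (B (B x)))\<^sup>2 \<le> (norm (B x))\<^sup>2"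
      by (intro power_mono contractive norm_ge_zero)
    ultimately have "(norm (X x))\<^sup>2 \<le> (norm x)\<^sup>2"
      using zero_le_power2[of "norm (B x)"] by linarith
    then show ?thesis by (rule power2_le_imp_le) simp
  qed
  then have "norm X \<le> 1"
    by (intro norm_blinfun_bound) simp_all
  then obtain Y where norm_Y: "norm Y \<le> 1" and Y: "Y = (1/2) *\<^sub>R (X + (Y o\<^sub>L Y))"
    and comm: "\<And>D. D o\<^sub>L X = X o\<^sub>L D \<Longrightarrow> D o\<^sub>L Y = Y o\<^sub>L D"
    by (rule operator_quadratic_fixed_point) blast
  define S where "S = id_blinfun - Y"
  have S_apply: "S x = x - Y x" for x
    by (simp add: S_def blinfun.bilinear_simps)
  show thesis
  proof
    fix x
    have "2 *\<^sub>R Y = X + (Y o\<^sub>L Y)"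
      using arg_cong[OF Y, of "\<lambda>Z. 2 *\<^sub>R Z"] by (simp only: scaleR_scaleR) simp
    then have "2 *\<^sub>R Y x = X x + Y (Y x)"
      by (metis blinfun.scaleR_left blinfun.add_left blinfun_apply_blinfun_compose)
    then show "S (S x) = B (B x)"
      by (simp add: S_apply X_apply blinfun.bilinear_simps scaleR_2 algebra_simps)
    have "rinner (Y x) x \<le> norm (Y x) * norm x" by (rule rinner_le_norm)
    also have "\<dots> \<le> norm x * norm x"
      using norm_blinfun[of Y x] norm_Y mult_right_mono[of "norm Y" 1 "norm x"]
      by (intro mult_right_mono) auto
    finally show "0 \<le> rinner (S x) x"
      by (simp add: S_apply rinner_simps power2_eq_square)
  next
    fix D assume D: "D o\<^sub>L B = B o\<^sub>L D"
    have DB: "D (B x) = B (D x)" for x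
      using D by (metis blinfun_apply_blinfun_compose)
    have "D o\<^sub>L X = X o\<^sub>L D"
      by (rule blinfun_eqI) (simp add: X_apply blinfun.bilinear_simps DB)
    then have "D o\<^sub>L Y = Y o\<^sub>L D" by (rule comm)
    then have DY: "D (Y x) = Y (D x)" for x
      by (metis blinfun_apply_blinfun_compose)
    show "D o\<^sub>L S = S o\<^sub>L D"
      by (rule blinfun_eqI) (simp add: S_apply blinfun.bilinear_simps DY)
  qed
qed

lemma closed_csubspace_kernel:
  fixes F :: "'a::complex_hilbert_space \<Rightarrow>\<^sub>L 'a"
  assumes "\<And>c x. F (c *\<^sub>C x) = c *\<^sub>C F x"
  shows "closed_csubspace {x. F x = 0}"
  unfolding closed_csubspace_def complex_vector.subspace_def
  by (auto simp: assms blinfun.bilinear_simps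
      intro!: closed_Collect_eq continuous_intros)

text \<open>
  The invariant subspace in question is the kernel of \<open>F = S - C\<close>, where \<open>S\<close> is the absolute
  value of the rescaled operator \<open>C\<close>. Since \<open>S\<close> commutes with every operator that commutes with
  \<open>C\<close>, taking multiplication by a complex number for that operator shows that \<open>S\<close>, constructed
  over the reals, is complex-linear. A zero kernel forces \<open>S = -C\<close>, a full one \<open>S = C\<close>.
\<close>

lemma symmetric_sign_if_no_invariant_subspace:
  fixes B T :: "'a::complex_hilbert_space \<Rightarrow>\<^sub>L 'a"
  assumes transitive: "\<nexists>M. nontrivial_invariant_subspace T M"
    and symmetric: "\<And>x y. rinner (B x) y = rinner x (B y)"
    and clinear: "\<And>c x. B (c *\<^sub>C x) = c *\<^sub>C B x"
    and comm: "\<And>x. T (B x) = B (T x)"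
  shows "(\<forall>x. 0 \<le> rinner (B x) x) \<or> (\<forall>x. rinner (B x) x \<le> 0)"
proof -
  define a where "a = inverse (norm B + 1)"
  have a: "0 < a" unfolding a_def by (intro positive_imp_inverse_positive add_nonneg_pos) auto
  define C where "C = a *\<^sub>R B"
  have C_apply: "C x = a *\<^sub>R B x" for x by (simp add: C_def blinfun.bilinear_simps)
  have "norm C \<le> 1"
    using norm_ge_zero[of B] by (simp add: C_def a_def inverse_eq_divide abs_of_pos add_nonneg_pos)
  moreover have "rinner (C x) y = rinner x (C y)" for x y
    by (simp only: C_apply rinner_scaleR_left rinner_scaleR_right symmetric)
  ultimately obtain S :: "'a \<Rightarrow>\<^sub>L 'a" where S2: "\<And>x. S (S x) = C (C x)" and S_pos: "\<And>x. 0 \<le> rinner (S x) x"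
    and S_comm: "\<And>D. D o\<^sub>L C = C o\<^sub>L D \<Longrightarrow> D o\<^sub>L S = S o\<^sub>L D"
    by (rule symmetric_absolute_value) blast
  have commute: "D (S x) = S (D x)" if "\<And>x. D (C x) = C (D x)"
    for D :: "'a \<Rightarrow>\<^sub>L 'a" and x
  proof -
    have "D o\<^sub>L C = C o\<^sub>L D" by (rule blinfun_eqI) (simp add: that)
    from S_comm[OF this] show ?thesis by (metis blinfun_apply_blinfun_compose)
  qed
  have S_clinear: "S (c *\<^sub>C x) = c *\<^sub>C S x" for c x
    using commute[of "Blinfun (\<lambda>x. c *\<^sub>C x)" x]
    by (simp add: bounded_linear_Blinfun_apply bounded_linear_scaleC C_apply clinear scaleC_scaleR)
  have TS: "T (S x) = S (T x)" for x
    by (rule commute) (simp add: C_apply blinfun.bilinear_simps comm)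
  have CS: "C (S x) = S (C x)" for x
    by (rule commute) simp
  define F where "F = S - C"
  have F_apply: "F x = S x - C x" for x by (simp add: F_def blinfun.bilinear_simps)
  have F_clinear: "F (c *\<^sub>C x) = c *\<^sub>C F x" for c x
    using complex_vector.scale_right_diff_distrib[of c "S x" "C x"]
    by (simp add: F_apply S_clinear C_apply clinear scaleC_scaleR)
  have "T ` {x. F x = 0} \<subseteq> {x. F x = 0}"
    by (auto simp: F_apply C_apply simp flip: TS comm blinfun.scaleR_right)
  with transitive closed_csubspace_kernel[of F, OF F_clinear]
  consider "{x. F x = 0} = {0}" | "{x. F x = 0} = UNIV"
    unfolding nontrivial_invariant_subspace_def by blast
  then show ?thesis
  proof cases
    case 1
    have "F (S x + C x) = 0" for x
      by (simp add: F_apply blinfun.bilinear_simps S2 CS)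
    with 1 have "S x + C x = 0" for x by blast
    then have "C x = - S x" for x by (simp add: eq_neg_iff_add_eq_0 add.commute)
    then have "a * rinner (B x) x = - rinner (S x) x" for x
      by (metis C_apply rinner_scaleR_left rinner_minus_left)
    then have "a * rinner (B x) x \<le> 0" for x using S_pos[of x] by simp
    then show ?thesis using a by (simp add: mult_le_0_iff)
  next
    case 2
    then have "F x = 0" for x by blast
    then have "C x = S x" for x by (simp add: F_apply)
    then have "0 \<le> a * rinner (B x) x" for x
      by (metis C_apply rinner_scaleR_left S_pos)
    then show ?thesis using a by (simp add: zero_le_mult_iff)
  qed
qed

lemma symmetric_eq_0_if_form_eq_0:
  fixes B :: "'a::complex_hilbert_space \<Rightarrow>\<^sub>L 'a"
  assumes symmetric: "\<And>x y. rinner (B x) y = rinner x (B y)"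
    and form: "\<And>x. rinner (B x) x = 0"
  shows "B x = 0"
proof -
  have "0 = rinner (B (x + B x)) (x + B x)" by (simp only: form)
  also have "\<dots> = 2 * rinner (B x) (B x)"
    using form symmetric[of "B x" x]
    by (simp add: blinfun.bilinear_simps rinner_add_left rinner_add_right)
  finally show ?thesis by (simp add: rinner_self)
qed

text \<open>
  Shifting \<open>A\<close> by a real number keeps it symmetric and commuting with \<open>T\<close>, so each of its
  shifts has a definite sign when \<open>T\<close> has no non-trivial invariant subspace.
  Two different values of the quadratic form on the unit sphere would be separated by a shift
  whose form takes both signs.
\<close>

lemma symmetric_commuting_scalar:
  fixes A T :: "'a::complex_hilbert_space \<Rightarrow>\<^sub>L 'a"
  assumes transitive: "\<nexists>M. nontrivial_invariant_subspace T M"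
    and symmetric: "\<And>x y. rinner (A x) y = rinner x (A y)"
    and clinear: "\<And>c x. A (c *\<^sub>C x) = c *\<^sub>C A x"
    and comm: "\<And>x. T (A x) = A (T x)"
  shows "\<exists>r. \<forall>x. A x = r *\<^sub>R x"
proof (cases "\<exists>e::'a. e \<noteq> 0")
  case False
  then show ?thesis by metis
next
  case True
  then obtain e :: 'a where e: "e \<noteq> 0" by blast
  define shift where "shift r = A - r *\<^sub>R id_blinfun" for r
  have shift_apply: "shift r x = A x - r *\<^sub>R x" for r x
    by (simp add: shift_def blinfun.bilinear_simps)
  have shift_symmetric: "rinner (shift r x) y = rinner x (shift r y)" for r x y
    by (simp only: shift_apply rinner_diff_left rinner_diff_right rinner_scaleR_left
        rinner_scaleR_right symmetric)
  have shift_form: "rinner (shift r x) x = rinner (A x) x - r * (norm x)\<^sup>2" for r x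
    by (simp only: shift_apply rinner_diff_left rinner_scaleR_left rinner_self)
  have sign: "(\<forall>x. r * (norm x)\<^sup>2 \<le> rinner (A x) x) \<or> (\<forall>x. rinner (A x) x \<le> r * (norm x)\<^sup>2)" for r
  proof -
    have "shift r (c *\<^sub>C x) = c *\<^sub>C shift r x" for c x
      using complex_vector.scale_right_diff_distrib[of c "A x" "r *\<^sub>R x"]
      by (simp add: shift_apply clinear scaleC_scaleR)
    moreover have "T (shift r x) = shift r (T x)" for x
      by (simp add: shift_apply blinfun.bilinear_simps comm)
    ultimately have "(\<forall>x. 0 \<le> rinner (shift r x) x) \<or> (\<forall>x. rinner (shift r x) x \<le> 0)"
      by (intro symmetric_sign_if_no_invariant_subspace[OF transitive] shift_symmetric)
    then show ?thesis unfolding shift_form by simp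
  qed
  define q where "q x = rinner (A x) x / (norm x)\<^sup>2" for x
  have no_gap: "\<not> q x < q y" if "x \<noteq> 0" "y \<noteq> 0" for x y
  proof
    assume "q x < q y"
    then obtain r where r: "q x < r" "r < q y" using dense by blast
    then have "rinner (A x) x < r * (norm x)\<^sup>2" and "r * (norm y)\<^sup>2 < rinner (A y) y"
      using that by (simp_all add: q_def field_simps)
    with sign[of r] show False by (meson not_le)
  qed
  have "rinner (shift (q e) x) x = 0" for x
  proof (cases "x = 0")
    case False
    then have "q x = q e" using no_gap[OF False e] no_gap[OF e False] by linarith
    then show ?thesis using False by (simp add: shift_form q_def field_simps)
  qed (simp add: shift_form blinfun.bilinear_simps rinner_simps cinner_add_left)
  then have "shift (q e) x = 0" for x
    by (rule symmetric_eq_0_if_form_eq_0[OF shift_symmetric])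
  then show ?thesis by (auto simp: shift_apply)
qed

section \<open>Scalar and unitary operators\<close>

text \<open>
  The orthogonal complement of a non-zero vector is invariant under every scalar operator, and
  it is zero only if the vector spans the space.
\<close>

lemma scalar_nontrivial_invariant_subspace:
  fixes T :: "'a::complex_hilbert_space \<Rightarrow> 'a"
  assumes infinite_dim: "infinite_dimensional TYPE('a)"
    and scalar: "\<And>x. T x = z *\<^sub>C x"
  shows "\<exists>M. nontrivial_invariant_subspace T M"
proof -
  have "cspan {0} \<noteq> (UNIV :: 'a set)"
    using infinite_dim unfolding infinite_dimensional_def by blast
  then obtain e :: 'a where e: "e \<noteq> 0"
    using complex_vector.span_zero[of "{0}"] by (metis UNIV_eq_I)
  have cinner_e: "cinner e e \<noteq> 0" using e by (simp add: cinner_self)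
  define M where "M = {x. cinner x e = 0}"
  have Im_cinner: "Im (cinner x e) = - rinner (\<i> *\<^sub>C x) e" for x
    by (simp add: cinner_scaleC_left)
  have "M = {x. rinner x e = 0} \<inter> {x. rinner (\<i> *\<^sub>C x) e = 0}"
    by (auto simp: M_def complex_eq_iff Im_cinner)
  moreover have "closed {x. rinner x e = 0}" and "closed {x. rinner (\<i> *\<^sub>C x) e = 0}"
    by (intro closed_Collect_eq continuous_on_const linear_continuous_on
        bounded_linear_rinner_left bounded_linear_compose[OF bounded_linear_rinner_left]
        bounded_linear_scaleC)+
  ultimately have "closed M" by auto
  moreover have "csubspace M"
    using cinner_scaleC_left[of 0 0 e]
    by (auto simp: complex_vector.subspace_def M_def cinner_add_left cinner_scaleC_left)
  moreover have "T ` M \<subseteq> M"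
    by (auto simp: M_def scalar cinner_scaleC_left)
  moreover have "M \<noteq> UNIV" using cinner_e by (auto simp: M_def)
  moreover have "M \<noteq> {0}"
  proof
    assume M0: "M = {0}"
    have "x \<in> cspan {e}" for x
    proof -
      let ?c = "cinner x e / cinner e e"
      have "cinner (x + (- ?c) *\<^sub>C e) e = 0"
        using cinner_e by (simp only: cinner_add_left cinner_scaleC_left) simp
      then have "x + (- ?c) *\<^sub>C e = 0" using M0 unfolding M_def by blast
      then have "x = ?c *\<^sub>C e"
        by (simp only: complex_vector.scale_minus_left add_uminus_conv_diff right_minus_eq)
      then show ?thesis
        by (metis complex_vector.span_base complex_vector.span_scale singletonI)
    qed
    then have "cspan {e} = UNIV" by blast
    then show False using infinite_dim unfolding infinite_dimensional_def by blast
  qed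
  ultimately show ?thesis
    unfolding nontrivial_invariant_subspace_def closed_csubspace_def by blast
qed

text \<open>
  The self-adjoint operators \<open>c T + cnj c V\<close>, with \<open>V\<close> the adjoint and inverse of \<open>T\<close>, treat the
  real part (\<open>c = 1\<close>) and the imaginary part (\<open>c = \<i>\<close>) at once, up to real factors. If both are
  scalar, \<open>T\<close> is a scalar too.
\<close>

lemma unitary_nontrivial_invariant_subspace:
  fixes T :: "'a::complex_hilbert_space \<Rightarrow> 'a"
  assumes infinite_dim: "infinite_dimensional TYPE('a)"
    and bounded: "bounded_clinear T"
    and unitary: "unitary_on UNIV T"
  shows "\<exists>M. nontrivial_invariant_subspace T M"
proof (rule ccontr)
  assume transitive: "\<nexists>M. nontrivial_invariant_subspace T M"
  obtain V where adj: "\<And>x y. cinner (T x) y = cinner x (V y)"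
    and VT: "\<And>x. V (T x) = x" and TV: "\<And>x. T (V x) = x"
    using unitary unfolding unitary_on_def is_adjoint_on_def by auto
  interpret T: Vector_Spaces.linear scaleC scaleC T
    using bounded by (simp add: bounded_clinear_def)
  have V_add: "V (x + y) = V x + V y" for x y
    using T.add[of "V x" "V y"] VT[of "V x + V y"] by (simp add: TV)
  have V_scale: "V (c *\<^sub>C x) = c *\<^sub>C V x" for c x
    using T.scale[of c "V x"] VT[of "c *\<^sub>C V x"] by (simp add: TV)
  have norm_T: "norm (T x) = norm x" for x
  proof -
    have "(norm (T x))\<^sup>2 = (norm x)\<^sup>2"
      by (simp only: rinner_self[symmetric] adj VT)
    then show ?thesis by (simp add: power2_eq_iff_nonneg)
  qed
  have norm_V: "norm (V x) = norm x" for x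
    using norm_T[of "V x"] by (simp add: TV)
  have bl_T: "bounded_linear T"
    by (rule bounded_linear_intro[where K = 1])
       (simp_all add: T.add T.scale scaleR_eq_scaleC norm_T)
  have bl_V: "bounded_linear V"
    by (rule bounded_linear_intro[where K = 1])
       (simp_all add: V_add V_scale scaleR_eq_scaleC norm_V)
  have scalar: "\<exists>r. \<forall>x. c *\<^sub>C T x + cnj c *\<^sub>C V x = r *\<^sub>R x" for c
  proof -
    define A where "A = Blinfun (\<lambda>x. c *\<^sub>C T x + cnj c *\<^sub>C V x)"
    have A_apply: "A x = c *\<^sub>C T x + cnj c *\<^sub>C V x" for x
      unfolding A_def
      by (intro bounded_linear_Blinfun_apply[THEN fun_cong] bounded_linear_add
          bounded_linear_compose[OF bounded_linear_scaleC] bl_T bl_V)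
    have T_apply: "blinfun_apply (Blinfun T) = T"
      by (rule bounded_linear_Blinfun_apply[OF bl_T])
    have adj_V: "cinner (V x) y = cinner x (T y)" for x y
      by (metis adj cinner_commute)
    have scaleC_right: "cinner x (b *\<^sub>C y) = cnj b * cinner x y" for b and x y :: 'a
      by (metis cinner_commute cinner_scaleC_left complex_cnj_mult complex_cnj_cnj)
    have "rinner (A x) y = rinner x (A y)" for x y
      by (simp only: A_apply rinner_add_left rinner_add_right cinner_scaleC_left scaleC_right
          adj adj_V complex_cnj_cnj add.commute)
    moreover have "A (b *\<^sub>C x) = b *\<^sub>C A x" for b x
      by (simp add: A_apply T.scale V_scale scaleC_add_right scaleC_scaleC mult.commute)
    moreover have "Blinfun T (A x) = A (Blinfun T x)" for x
      by (simp add: A_apply T_apply T.add T.scale TV VT)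
    ultimately show ?thesis
      using symmetric_commuting_scalar[of "Blinfun T" A] transitive
      unfolding T_apply A_apply by blast
  qed
  from scalar[of 1] obtain r where r: "\<And>x. T x + V x = r *\<^sub>R x"
    by (auto simp: scaleC_one)
  from scalar[of "\<i>"] obtain s where s: "\<And>x. \<i> *\<^sub>C T x + (- \<i>) *\<^sub>C V x = s *\<^sub>R x"
    by auto
  \<comment> \<open>\<open>2 T = (T + V) - \<i> (\<i> T - \<i> V)\<close>\<close>
  have "T x = ((r - \<i> * s) / 2) *\<^sub>C x" for x
  proof -
    have "2 *\<^sub>C T x = (T x + V x) + (- \<i>) *\<^sub>C (\<i> *\<^sub>C T x + (- \<i>) *\<^sub>C V x)"
      using scaleC_add_left[of 1 1 "T x"]
      by (simp only: scaleC_add_right scaleC_scaleC) (simp add: scaleC_one)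
    also have "\<dots> = (r - \<i> * s) *\<^sub>C x"
      unfolding r s scaleR_eq_scaleC scaleC_scaleC scaleC_add_left[symmetric] by simp
    finally have "(1/2) *\<^sub>C (2 *\<^sub>C T x) = (1/2) *\<^sub>C ((r - \<i> * s) *\<^sub>C x)" by simp
    then show ?thesis by (simp only: scaleC_scaleC) (simp add: scaleC_one)
  qed
  with transitive show False
    using scalar_nontrivial_invariant_subspace[OF infinite_dim] by blast
qed

theorem corollary2p7:
  fixes T :: "'a::complex_hilbert_space \<Rightarrow> 'a"
  assumes separable: "separable_space (euclidean :: 'a topology)"
    and infinite_dim: "infinite_dimensional TYPE('a)"
    and contraction: "contraction T"
    and not_cnu: "\<not> completely_non_unitary T"
  shows "\<exists>M. nontrivial_invariant_subspace T M"
proof -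
  obtain M where M: "reducing_subspace T M" "M \<noteq> {0}" "unitary_on M T"
    using not_cnu unfolding completely_non_unitary_def by blast
  show ?thesis
  proof (cases "M = UNIV")
    case True
    then show ?thesis
      using unitary_nontrivial_invariant_subspace[OF infinite_dim] contraction M(3)
      by (auto simp: contraction_def)
  next
    case False
    then have "nontrivial_invariant_subspace T M"
      using M by (simp add: nontrivial_invariant_subspace_def reducing_subspace_def)
    then show ?thesis by blast
  qed
qed

end
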